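(* Let $a,b,c$ be nonzero integers, not all of the same sign, and let $E$ denote the equation $ax+by+cz=0$. Then $E$ is uncommon over $[n]$, i.e. \[\limsup_{n\to\infty}\mu_E([n]) < \frac14 .\]
   Context: For $n\in\mathbb{N}$, $[n]=\{1,2,\dots,n\}$. For an equation $E: a_1x_1+\cdots+a_kx_k=0$ with integer coefficients and a finite set $A$ on which the equation makes sense (here $A=[n]$), let $T_E(A)=\{(x_1,\dots,x_k)\in A^k : a_1x_1+\cdots+a_kx_k=0\}$. A coloring is a function $f:A\to\{-1,1\}$; the set of monochromatic solutions is $M_E(f)=\{(x_1,\dots,x_k)\in T_E(A): f(x_1)=\cdots=f(x_k)\}$, and $\mu_E(f)=|M_E(f)|/|T_E(A)|$. Finally $\mu_E(A)=\min_{f:A\to\{-1,1\}}\mu_E(f)$. An equation in $k$ variables is called uncommon over $[n]$ if $\limsup_{n\to\infty}\mu_E([n])<2^{1-k}$ (here $k=3$, so the threshold is $1/4$, the expected monochromatic proportion under a uniformly random coloring). *)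

theory Defs
  imports "HOL-Analysis.Analysis"
begin

(* The equation a_1 x_1 + ... + a_k x_k = 0 is represented by its coefficient list
   [a_1, ..., a_k], and a k-tuple of elements of A by a list of length k. *)

definition solutions :: "int list \<Rightarrow> int set \<Rightarrow> int list set" where
  "solutions E A =
     {xs. length xs = length E \<and> set xs \<subseteq> A \<and> (\<Sum>i<length E. E ! i * xs ! i) = 0}"

(* Colorings are extensional functions, so that a finite A has finitely many of them
   and the minimum below is attained. *)
definition colorings :: "int set \<Rightarrow> (int \<Rightarrow> int) set" where
  "colorings A = (A \<rightarrow>\<^sub>E {-1, 1})"

definition mono_solutions :: "int list \<Rightarrow> int set \<Rightarrow> (int \<Rightarrow> int) \<Rightarrow> int list set" where
  "mono_solutions E A f = {xs \<in> solutions E A. \<forall>x\<in>set xs. \<forall>y\<in>set xs. f x = f y}"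

(* If there are no solutions in A, the quotient is 0 by the convention x / 0 = 0. *)
definition mono_ratio :: "int list \<Rightarrow> int set \<Rightarrow> (int \<Rightarrow> int) \<Rightarrow> real" where
  "mono_ratio E A f = real (card (mono_solutions E A f)) / real (card (solutions E A))"

(* Only meaningful for finite A. *)
definition min_mono_ratio :: "int list \<Rightarrow> int set \<Rightarrow> real" where
  "min_mono_ratio E A = Min (mono_ratio E A ` colorings A)"

(* limsup lives in complete linear orders, hence the embedding into ereal. *)
definition uncommon :: "int list \<Rightarrow> bool" where
  "uncommon E \<longleftrightarrow>
     limsup (\<lambda>n. ereal (min_mono_ratio E {1..int n})) < ereal (2 powi (1 - int (length E)))"

lemma uncommon_three:
  "uncommon [a, b, c] \<longleftrightarrow> limsup (\<lambda>n. ereal (min_mono_ratio [a, b, c] {1..int n})) < 1 / 4"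
proof -
  have "ereal (2 powi (1 - int (length [a, b, c]))) = 1 / 4"
    by (simp add: power_int_def one_ereal_def numeral_eq_ereal power2_eq_square)
  then show ?thesis
    unfolding uncommon_def by simp
qed

lemma solutions_three:
  "solutions [a, b, c] A =
     {[x, y, z] | x y z. x \<in> A \<and> y \<in> A \<and> z \<in> A \<and> a * x + b * y + c * z = 0}"
  by (auto simp: solutions_def numeral_3_eq_3 length_Suc_conv)

end

(* For f with values -1 and 1, a solution (x, y, z) is monochromatic iff
   (1 + f x f y + f x f z + f y f z) / 4 equals 1, and otherwise this number is 0. So it suffices to
   make the sum of the products of pairs, a quadratic form Q in f, at most - \<delta> n^2. Up to its
   diagonal, which contributes O(n), Q is affine in each value of f; hence f may take values in the
   whole interval [-1, 1] and can be rounded afterwards.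

   Up to symmetry the equation is a x + b y = c z with a, b, c > 0. On multiples of a b c the
   coefficients of Q depend only on the positions u / n, v / n: they are given by a kernel on the
   unit square that is piecewise constant, with jumps along lines. Take nearby intervals I and J
   on whose union the symmetrized kernel is constant off the diagonal, and an interval R whose
   elements see I and J differently. The difference of the indicators of J and I then makes Q
   vanish up to O(n), and adding a small multiple of the indicator of R makes it negative
   of order n^2. *)
theory Submission
  imports Defs
begin

section \<open>The quadratic form of a coloring and its rounding to signs\<close>

definition pair_sum :: "int \<Rightarrow> int \<Rightarrow> int \<Rightarrow> int set \<Rightarrow> (int \<Rightarrow> real) \<Rightarrow> real" where
  "pair_sum a b c A f =
     (\<Sum>x\<in>A. \<Sum>y\<in>A. \<Sum>z\<in>A. of_bool (a * x + b * y + c * z = 0) * (f x * f y + f x * f z + f y * f z))"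

text \<open>The pair \<open>(u, v)\<close> fills the positions \<open>(x, y)\<close>,
  \<open>(x, z)\<close> and \<open>(y, z)\<close>, always in this order. The weight is therefore not
  symmetric, and later conditions concern the sum over both orders.\<close>

definition pair_weight :: "int \<Rightarrow> int \<Rightarrow> int \<Rightarrow> int set \<Rightarrow> int \<Rightarrow> int \<Rightarrow> real" where
  "pair_weight a b c A u v =
     (\<Sum>w\<in>A. of_bool (a * u + b * v + c * w = 0)) + (\<Sum>w\<in>A. of_bool (a * u + b * w + c * v = 0))
       + (\<Sum>w\<in>A. of_bool (a * w + b * u + c * v = 0))"

lemma pair_sum_swap12: "pair_sum a b c A f = pair_sum b a c A f"
  unfolding pair_sum_def by (subst sum.swap) (simp add: algebra_simps)

lemma pair_sum_swap23: "pair_sum a b c A f = pair_sum a c b A f"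
  unfolding pair_sum_def
  by (rule sum.cong[OF refl], subst sum.swap) (simp add: algebra_simps)

lemma pair_sum_uminus: "pair_sum (- a) (- b) (- c) A f = pair_sum a b c A f"
proof -
  have "(- a * x + - b * y + - c * z = 0) = (a * x + b * y + c * z = 0)" for x y z
    by linarith
  then show ?thesis unfolding pair_sum_def by simp
qed

lemma pair_sum_eq_pair_weight:
  "pair_sum a b c A f = (\<Sum>u\<in>A. \<Sum>v\<in>A. pair_weight a b c A u v * f u * f v)"
proof -
  \<comment> \<open>Each of the three products misses one variable; moving the sum over it inside
    turns the indicator into one summand of the weight.\<close>
  let ?T = "\<lambda>x y z. of_bool (a * x + b * y + c * z = 0) :: real"
  have 1: "(\<Sum>x\<in>A. \<Sum>y\<in>A. \<Sum>z\<in>A. ?T x y z * (f x * f z))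
      = (\<Sum>u\<in>A. \<Sum>v\<in>A. (\<Sum>w\<in>A. ?T u w v) * f u * f v)"
    by (rule sum.cong[OF refl], subst sum.swap) (simp add: sum_distrib_right mult.assoc)
  have 2: "(\<Sum>x\<in>A. \<Sum>y\<in>A. \<Sum>z\<in>A. ?T x y z * (f y * f z))
      = (\<Sum>u\<in>A. \<Sum>v\<in>A. (\<Sum>w\<in>A. ?T w u v) * f u * f v)"
    by (subst sum.swap, rule sum.cong[OF refl], subst sum.swap)
      (simp add: sum_distrib_right mult.assoc)
  have 3: "(\<Sum>x\<in>A. \<Sum>y\<in>A. \<Sum>z\<in>A. ?T x y z * (f x * f y))
      = (\<Sum>u\<in>A. \<Sum>v\<in>A. (\<Sum>w\<in>A. ?T u v w) * f u * f v)"
    by (simp add: sum_distrib_right mult.assoc)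
  have "pair_sum a b c A f = (\<Sum>x\<in>A. \<Sum>y\<in>A. \<Sum>z\<in>A. ?T x y z * (f x * f y))
     + (\<Sum>x\<in>A. \<Sum>y\<in>A. \<Sum>z\<in>A. ?T x y z * (f x * f z))
     + (\<Sum>x\<in>A. \<Sum>y\<in>A. \<Sum>z\<in>A. ?T x y z * (f y * f z))"
    unfolding pair_sum_def distrib_left sum.distrib by simp
  then show ?thesis
    unfolding 1 2 3 pair_weight_def distrib_right sum.distrib by simp
qed

lemma sum_of_bool_le_one:
  fixes A :: "int set"
  assumes "finite A" and "\<And>x y. P x \<Longrightarrow> P y \<Longrightarrow> x = y"
  shows "(\<Sum>w\<in>A. of_bool (P w)) \<le> (1 :: real)"
proof -
  have "card (A \<inter> {w. P w}) \<le> 1"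
    using assms by (intro card_le_Suc0_iff_eq[THEN iffD2, simplified One_nat_def[symmetric]]) auto
  then show ?thesis using assms(1) by (simp add: sum.If_cases of_bool_def)
qed

text \<open>In each of the three equations \<open>u\<close> and \<open>v\<close> determine
  \<open>w\<close>, because the coefficient of \<open>w\<close> is nonzero; hence each summand is 0
  or 1.\<close>

lemma pair_weight_bounds:
  assumes "finite A" "a \<noteq> 0" "b \<noteq> 0" "c \<noteq> 0"
  shows "0 \<le> pair_weight a b c A u v" "pair_weight a b c A u v \<le> 3"
proof -
  show "0 \<le> pair_weight a b c A u v"
    unfolding pair_weight_def by (intro add_nonneg_nonneg sum_nonneg) auto
  have "(\<Sum>w\<in>A. of_bool (a * u + b * v + c * w = 0)) \<le> (1 :: real)"
  proof (intro sum_of_bool_le_one assms)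
    fix x y assume "a * u + b * v + c * x = 0" "a * u + b * v + c * y = 0"
    then have "c * x = c * y" by linarith
    then show "x = y" using assms by simp
  qed
  moreover have "(\<Sum>w\<in>A. of_bool (a * u + b * w + c * v = 0)) \<le> (1 :: real)"
  proof (intro sum_of_bool_le_one assms)
    fix x y assume "a * u + b * x + c * v = 0" "a * u + b * y + c * v = 0"
    then have "b * x = b * y" by linarith
    then show "x = y" using assms by simp
  qed
  moreover have "(\<Sum>w\<in>A. of_bool (a * w + b * u + c * v = 0)) \<le> (1 :: real)"
  proof (intro sum_of_bool_le_one assms)
    fix x y assume "a * x + b * u + c * v = 0" "a * y + b * u + c * v = 0"
    then have "a * x = a * y" by linarith
    then show "x = y" using assms by simp
  qed
  ultimately show "pair_weight a b c A u v \<le> 3"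
    unfolding pair_weight_def by linarith
qed

text \<open>The form is affine in each value of \<open>g\<close>, so moving the values to an endpoint one
  at a time need not increase it.\<close>

lemma exists_sign_rounding:
  fixes W :: "'a \<Rightarrow> 'a \<Rightarrow> real"
  assumes "finite A" and "\<And>x. x \<in> A \<Longrightarrow> W x x = 0" and "\<And>x. x \<in> A \<Longrightarrow> \<bar>g x\<bar> \<le> 1"
  shows "\<exists>f. (\<forall>x\<in>A. f x \<in> {-1, 1}) \<and>
    (\<Sum>u\<in>A. \<Sum>v\<in>A. W u v * f u * f v) \<le> (\<Sum>u\<in>A. \<Sum>v\<in>A. W u v * g u * g v)"
proof -
  define Q where "Q f = (\<Sum>u\<in>A. \<Sum>v\<in>A. W u v * f u * f v)" for f
  \<comment> \<open>The induction runs over the set \<open>B\<close> of points already rounded; at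
    all other points of \<open>A\<close> the values only stay in [-1, 1].\<close>
  have "\<exists>f. (\<forall>x\<in>B. f x \<in> {-1, 1}) \<and> (\<forall>x\<in>A. \<bar>f x\<bar> \<le> 1) \<and> Q f \<le> Q g"
    if "finite B" "B \<subseteq> A" for B
    using that
  proof (induction B rule: finite_induct)
    case empty
    then show ?case using assms(3) by auto
  next
    case (insert x B)
    then obtain f where f: "\<forall>y\<in>B. f y \<in> {-1, 1}" "\<forall>y\<in>A. \<bar>f y\<bar> \<le> 1" "Q f \<le> Q g"
      by auto
    define C where "C = (\<Sum>u\<in>A-{x}. \<Sum>v\<in>A-{x}. W u v * f u * f v)"
    define L where "L = (\<Sum>v\<in>A-{x}. W x v * f v) + (\<Sum>u\<in>A-{x}. W u x * f u)"
    have xA: "x \<in> A" using insert.prems by auto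
    \<comment> \<open>The square of \<open>t\<close> would come with the coefficient
      \<open>W x x\<close>, which is 0.\<close>
    have affine: "Q (f(x := t)) = C + t * L" for t
    proof -
      have "Q (f(x := t)) = (\<Sum>v\<in>A-{x}. W x v * t * f v)
          + (\<Sum>u\<in>A-{x}. W u x * f u * t + (\<Sum>v\<in>A-{x}. W u v * f u * f v))"
        unfolding Q_def using assms(2) xA by (simp add: sum.remove[OF assms(1) xA])
      moreover have "(\<Sum>v\<in>A-{x}. W x v * t * f v) = t * (\<Sum>v\<in>A-{x}. W x v * f v)"
        by (simp add: sum_distrib_left mult_ac)
      moreover have "(\<Sum>u\<in>A-{x}. W u x * f u * t) = t * (\<Sum>u\<in>A-{x}. W u x * f u)"
        by (simp add: sum_distrib_left mult_ac)
      ultimately show ?thesis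
        unfolding C_def L_def sum.distrib by (simp add: distrib_left)
    qed
    have fx: "\<bar>f x\<bar> \<le> 1" using f(2) xA by auto
    \<comment> \<open>The end point opposite in sign to the slope minimizes \<open>t * L\<close>
      over [-1, 1].\<close>
    define t :: real where "t = (if L \<ge> 0 then -1 else 1)"
    have "t * L \<le> f x * L"
    proof (cases "L \<ge> 0")
      case True
      then show ?thesis using fx mult_right_mono[of "-1" "f x" L] by (simp add: t_def)
    next
      case False
      then show ?thesis using fx mult_right_mono_neg[of "f x" 1 L] by (simp add: t_def)
    qed
    then have "Q (f(x := t)) \<le> Q f"
      using affine[of t] affine[of "f x"] by simp
    then have "Q (f(x := t)) \<le> Q g" using f(3) by linarith
    moreover have "\<forall>y\<in>insert x B. (f(x := t)) y \<in> {-1, 1}" "\<forall>y\<in>A. \<bar>(f(x := t)) y\<bar> \<le> 1"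
      using f by (auto simp: t_def)
    ultimately show ?case by blast
  qed
  from this[OF assms(1) order_refl] show ?thesis unfolding Q_def by blast
qed

section \<open>A negative value of the form from three blocks\<close>

lemma sum_of_bool_eq_left:
  assumes "finite A" "u \<in> A"
  shows "(\<Sum>v\<in>A. of_bool (u = v)) = (1 :: real)"
  using assms by (simp add: of_bool_def)

lemma sum_mult_indicator:
  fixes F :: "'a \<Rightarrow> real"
  assumes "finite A" "P \<subseteq> A"
  shows "(\<Sum>u\<in>A. F u * of_bool (u \<in> P)) = (\<Sum>u\<in>P. F u)"
proof -
  have "(\<Sum>u\<in>A. F u * of_bool (u \<in> P)) = (\<Sum>u\<in>A. if u \<in> P then F u else 0)"
    by (intro sum.cong) auto
  also have "\<dots> = (\<Sum>u\<in>P. F u)"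
    using assms by (simp add: sum.If_cases Int_absorb1)
  finally show ?thesis .
qed

lemma sum_sum_indicator:
  fixes W :: "'a \<Rightarrow> 'a \<Rightarrow> real"
  assumes "finite A" "P \<subseteq> A" "R \<subseteq> A"
  shows "(\<Sum>u\<in>A. \<Sum>v\<in>A. W u v * of_bool (u \<in> P) * of_bool (v \<in> R)) = (\<Sum>u\<in>P. \<Sum>v\<in>R. W u v)"
proof -
  have "(\<Sum>u\<in>A. \<Sum>v\<in>A. W u v * of_bool (u \<in> P) * of_bool (v \<in> R))
    = (\<Sum>u\<in>A. (\<Sum>v\<in>A. W u v * of_bool (v \<in> R)) * of_bool (u \<in> P))"
    unfolding sum_distrib_right by (simp add: mult_ac)
  then show ?thesis by (simp only: sum_mult_indicator assms)
qed

text \<open>Adding the transposed sum turns every off-diagonal term into \<open>d\<close>. A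
  diagonal term is at most 3 + 3 = 6, which is at most \<open>d + 6\<close> since \<open>d\<close>
  is nonnegative.\<close>

lemma sum_block_diagonal:
  fixes W :: "'a \<Rightarrow> 'a \<Rightarrow> real"
  assumes "finite P" and "\<And>u v. u \<in> P \<Longrightarrow> v \<in> P \<Longrightarrow> u \<noteq> v \<Longrightarrow> W u v + W v u = d"
    and "\<And>u. W u u \<le> 3" and "0 \<le> d"
  shows "2 * (\<Sum>u\<in>P. \<Sum>v\<in>P. W u v) \<le> d * real (card P)^2 + 6 * real (card P)"
proof -
  have "2 * (\<Sum>u\<in>P. \<Sum>v\<in>P. W u v) = (\<Sum>u\<in>P. \<Sum>v\<in>P. W u v) + (\<Sum>u\<in>P. \<Sum>v\<in>P. W v u)"
    by (subst (3) sum.swap) simp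
  also have "\<dots> = (\<Sum>u\<in>P. \<Sum>v\<in>P. W u v + W v u)" by (simp add: sum.distrib)
  also have "\<dots> \<le> (\<Sum>u\<in>P. \<Sum>v\<in>P. d + of_bool (u = v) * 6)"
  proof (intro sum_mono)
    fix u v assume "u \<in> P" "v \<in> P"
    then show "W u v + W v u \<le> d + of_bool (u = v) * 6"
      using assms(2)[of u v] assms(3)[of u] assms(4) by (cases "u = v") auto
  qed
  also have "\<dots> = d * real (card P)^2 + 6 * real (card P)"
    using assms(1) by (simp add: sum.distrib sum_distrib_right[symmetric] sum_of_bool_eq_left power2_eq_square algebra_simps)
  finally show ?thesis .
qed

text \<open>The gain is quadratic in \<open>s\<close>, while all losses are linear:
  \<open>3 * card A\<close> for restoring the diagonal after rounding, and a multiple of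
  \<open>s\<close> for the diagonals of the blocks \<open>P\<close> and \<open>P'\<close>.\<close>

lemma exists_negative_coloring:
  fixes W :: "'a \<Rightarrow> 'a \<Rightarrow> real"
  assumes A: "finite A" "P \<subseteq> A" "P' \<subseteq> A" "R \<subseteq> A"
    and card: "card P = s" "card P' = s" "card R = s"
    and disj: "P \<inter> P' = {}"
    and W0: "\<And>u v. 0 \<le> W u v" and W3: "\<And>u v. W u v \<le> 3" and d: "0 \<le> d"
    and diag: "\<And>u v. u \<in> P \<union> P' \<Longrightarrow> v \<in> P \<union> P' \<Longrightarrow> u \<noteq> v \<Longrightarrow> W u v + W v u = d"
    and high: "\<And>u v. u \<in> P \<Longrightarrow> v \<in> R \<Longrightarrow> e + 1 \<le> W u v + W v u"
    and low: "\<And>u v. u \<in> P' \<Longrightarrow> v \<in> R \<Longrightarrow> W u v + W v u \<le> e"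
  shows "\<exists>f. (\<forall>x\<in>A. f x \<in> {-1, 1}) \<and>
    (\<Sum>u\<in>A. \<Sum>v\<in>A. W u v * f u * f v) \<le> 3 * real (card A) + (6 * real s - real s ^ 2 / 16) / 16"
proof -
  \<comment> \<open>A weight r on \<open>R\<close> contributes at most (-r + 3 r^2) s^2, which is
    negative for 0 < r < 1/3; here r = 1/4. The outer factor 1/4 keeps the values in [-1, 1] even
    where \<open>R\<close> overlaps \<open>P\<close> or \<open>P'\<close>.\<close>
  define g where "g x = (of_bool (x \<in> P') - of_bool (x \<in> P) + of_bool (x \<in> R) / 4) / (4 :: real)" for x
  define S where "S X Y = (\<Sum>u\<in>X. \<Sum>v\<in>Y. W u v)" for X Y
  \<comment> \<open>Rounding requires a zero diagonal. Deleting it does not increase the form at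
    \<open>g\<close>, as the weights are nonnegative; putting it back costs at most 3 per element at
    \<open>f\<close>, whose squares are 1.\<close>
  define V where "V u v = (if u = v then 0 else W u v)" for u v
  have fin: "finite P" "finite P'" "finite R" using A by (auto intro: finite_subset)
  have V: "V x x = 0" and g: "\<bar>g x\<bar> \<le> 1" for x
    by (auto simp: V_def g_def of_bool_def)
  obtain f where f: "\<forall>x\<in>A. f x \<in> {-1, 1}"
    and fg: "(\<Sum>u\<in>A. \<Sum>v\<in>A. V u v * f u * f v) \<le> (\<Sum>u\<in>A. \<Sum>v\<in>A. V u v * g u * g v)"
    using exists_sign_rounding[of A V g, OF A(1) V g] by blast
  have "(\<Sum>u\<in>A. \<Sum>v\<in>A. V u v * g u * g v) \<le> (\<Sum>u\<in>A. \<Sum>v\<in>A. W u v * g u * g v)"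
    using W0 by (intro sum_mono) (auto simp: V_def mult.assoc)
  moreover have "(\<Sum>u\<in>A. \<Sum>v\<in>A. W u v * f u * f v) \<le> (\<Sum>u\<in>A. \<Sum>v\<in>A. V u v * f u * f v + of_bool (u = v) * 3)"
    using f W3 by (intro sum_mono) (auto simp: V_def mult.assoc)
  moreover have "\<dots> = (\<Sum>u\<in>A. \<Sum>v\<in>A. V u v * f u * f v) + 3 * real (card A)"
    using A(1) by (simp add: sum.distrib sum_distrib_right[symmetric] sum_of_bool_eq_left)
  ultimately have fle: "(\<Sum>u\<in>A. \<Sum>v\<in>A. W u v * f u * f v)
      \<le> 3 * real (card A) + (\<Sum>u\<in>A. \<Sum>v\<in>A. W u v * g u * g v)"
    using fg by linarith
  have expand: "W u v * g u * g v =
     (W u v * of_bool (u \<in> P') * of_bool (v \<in> P') + W u v * of_bool (u \<in> P) * of_bool (v \<in> P)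
      - W u v * of_bool (u \<in> P') * of_bool (v \<in> P) - W u v * of_bool (u \<in> P) * of_bool (v \<in> P')
      + 1/4 * (W u v * of_bool (u \<in> P') * of_bool (v \<in> R) + W u v * of_bool (u \<in> R) * of_bool (v \<in> P')
       - W u v * of_bool (u \<in> P) * of_bool (v \<in> R) - W u v * of_bool (u \<in> R) * of_bool (v \<in> P))
      + 1/16 * (W u v * of_bool (u \<in> R) * of_bool (v \<in> R))) / 16" for u v
    unfolding g_def by (simp add: field_simps)
  have "(\<Sum>u\<in>A. \<Sum>v\<in>A. W u v * g u * g v) = (S P' P' + S P P - S P' P - S P P'
     + 1/4 * (S P' R + S R P' - S P R - S R P) + 1/16 * S R R) / 16"
    unfolding expand sum.distrib sum_subtractf sum_divide_distrib[symmetric] sum_distrib_left[symmetric]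
    by (simp only: sum_sum_indicator A S_def)
  moreover have "2 * S P' P' \<le> d * real s^2 + 6 * real s"
    using sum_block_diagonal[of P' W d] fin diag W3 d card by (auto simp: S_def)
  moreover have "2 * S P P \<le> d * real s^2 + 6 * real s"
    using sum_block_diagonal[of P W d] fin diag W3 d card by (auto simp: S_def)
  moreover have "S P' P + S P P' = d * real s^2"
  proof -
    have "S P' P + S P P' = (\<Sum>u\<in>P'. \<Sum>v\<in>P. W u v + W v u)"
      unfolding S_def by (subst (2) sum.swap) (simp add: sum.distrib)
    also have "\<dots> = (\<Sum>u\<in>P'. \<Sum>v\<in>P. d)"
      using disj by (intro sum.cong refl diag) auto
    finally show ?thesis using card by (simp add: power2_eq_square mult_ac)
  qed
  moreover have "S P' R + S R P' \<le> e * real s^2"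
  proof -
    have "S P' R + S R P' = (\<Sum>u\<in>P'. \<Sum>v\<in>R. W u v + W v u)"
      unfolding S_def by (subst (2) sum.swap) (simp add: sum.distrib)
    also have "\<dots> \<le> (\<Sum>u\<in>P'. \<Sum>v\<in>R. e)"
      by (intro sum_mono low) auto
    finally show ?thesis using card by (simp add: power2_eq_square mult_ac)
  qed
  moreover have "(e + 1) * real s^2 \<le> S P R + S R P"
  proof -
    have "(\<Sum>u\<in>P. \<Sum>v\<in>R. e + 1) \<le> (\<Sum>u\<in>P. \<Sum>v\<in>R. W u v + W v u)"
      by (intro sum_mono high) auto
    also have "\<dots> = S P R + S R P"
      unfolding S_def by (subst (3) sum.swap) (simp add: sum.distrib)
    finally show ?thesis using card by (simp add: power2_eq_square mult_ac)
  qed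
  moreover have "S R R \<le> 3 * real s^2"
  proof -
    have "S R R \<le> (\<Sum>u\<in>R. \<Sum>v\<in>R. 3)"
      unfolding S_def by (intro sum_mono W3)
    then show ?thesis using card by (simp add: power2_eq_square mult_ac)
  qed
  \<comment> \<open>The blocks \<open>P\<close> and \<open>P'\<close> leave \<open>6 * s\<close>
    after the terms in \<open>d\<close> cancel; the interaction with \<open>R\<close> gives at most
    -s^2/4 and \<open>R\<close> with itself at most 3 s^2/16, together -s^2/16.\<close>
  ultimately have "(\<Sum>u\<in>A. \<Sum>v\<in>A. W u v * g u * g v) \<le> (6 * real s - real s ^ 2 / 16) / 16"
    by (simp add: algebra_simps)
  then show ?thesis using f fle by (intro exI[of _ f] conjI) linarith+
qed

section \<open>The limiting kernel and intervals that it separates\<close>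

text \<open>The three summands say when the missing variable \<open>z\<close>, \<open>y\<close> or \<open>x\<close> of
  \<open>a x + b y = c z\<close> lies in \<open>(0, 1]\<close>. In the first case positivity is
  automatic for the positive \<open>u\<close> and \<open>v\<close> considered here.\<close>

definition pair_kernel :: "real \<Rightarrow> real \<Rightarrow> real \<Rightarrow> real \<Rightarrow> real \<Rightarrow> real" where
  "pair_kernel a b c u v = of_bool (a * u + b * v \<le> c)
     + of_bool (0 < c * v - a * u \<and> c * v - a * u \<le> b)
     + of_bool (0 < c * v - b * u \<and> c * v - b * u \<le> a)"

text \<open>The continuous counterpart of the hypotheses of \<open>exists_negative_coloring\<close>,
  with \<open>I\<close> and \<open>J\<close> in the roles of \<open>P\<close> and \<open>P'\<close>.
  Equal arguments are left out because the kernel may jump across the diagonal when \<open>c\<close>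
  equals \<open>a\<close> or \<open>b\<close>. A gap of 1 is the natural one for an integer-valued
  kernel.\<close>

definition separates :: "(real \<Rightarrow> real \<Rightarrow> real) \<Rightarrow> real set \<Rightarrow> real set \<Rightarrow> real set \<Rightarrow> real \<Rightarrow> real \<Rightarrow> bool" where
  "separates k I J R d e \<longleftrightarrow> 0 \<le> d \<and> I \<inter> J = {}
     \<and> (\<forall>u\<in>I \<union> J. \<forall>v\<in>I \<union> J. u \<noteq> v \<longrightarrow> k u v + k v u = d)
     \<and> (\<forall>u\<in>I. \<forall>v\<in>R. e + 1 \<le> k u v + k v u)
     \<and> (\<forall>u\<in>J. \<forall>v\<in>R. k u v + k v u \<le> e)"

definition subinterval :: "real set \<Rightarrow> bool" where
  "subinterval I \<longleftrightarrow> (\<exists>l r. 0 \<le> l \<and> l < r \<and> r \<le> 1 \<and> I = {l<..<r})"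

lemma subintervalI: "0 \<le> l \<Longrightarrow> l < r \<Longrightarrow> r \<le> 1 \<Longrightarrow> subinterval {l<..<r}"
  unfolding subinterval_def by blast

text \<open>Allows one small parameter to be chosen subject to a whole list of strict inequalities,
  without computing a minimum of bounds.\<close>

lemma eventually_mult_less_at_right_0:
  fixes x y :: real
  assumes "0 < y"
  shows "\<forall>\<^sub>F t in at_right 0. x * t < y"
proof -
  have "((\<lambda>t. x * t) \<longlongrightarrow> x * 0) (at_right 0)" by (intro tendsto_intros)
  then show ?thesis using assms by (intro order_tendstoD(2)[where y = "x * 0"]) auto
qed

lemma eventually_impI: "(P \<Longrightarrow> eventually Q F) \<Longrightarrow> \<forall>\<^sub>F x in F. P \<longrightarrow> Q x"
  by (cases P) auto

text \<open>Close to the origin the upper bounds in the kernel are vacuous. The jump used is the line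
  \<open>c v = a u\<close>.\<close>

lemma pair_kernel_separates_large:
  fixes a b c :: real
  assumes pos: "0 < a" "0 < b" "0 < c" and "a \<le> b" and "b < c"
  shows "\<exists>I J R d e. subinterval I \<and> subinterval J \<and> subinterval R
    \<and> separates (pair_kernel a b c) I J R d e"
proof -
  have "\<forall>\<^sub>F \<rho> in at_right 0. (0 :: real) < \<rho> \<and> 2 * \<rho> < 1 \<and> (b + 2 * c) * \<rho> < c - b
      \<and> (a < b \<longrightarrow> (a + b) * \<rho> < b - a)"
    using assms
    by (intro eventually_conj eventually_mult_less_at_right_0 eventually_at_right_less
        eventually_impI) auto
  then obtain \<rho> where \<rho>: "0 < \<rho>" "2 * \<rho> < 1" "(b + 2 * c) * \<rho> < c - b"
      "a < b \<Longrightarrow> (a + b) * \<rho> < b - a"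
    using eventually_happens trivial_limit_at_right_real by blast
  \<comment> \<open>The point \<open>(t, s)\<close> lies on the line \<open>c v = a u\<close>. The
    choice \<open>c * t = a / 2\<close> makes \<open>t\<close> small enough for all upper bounds in
    the kernel to hold below \<open>t\<close>.\<close>
  define t where "t = a / (2 * c)"
  define s where "s = a * t / c"
  have t: "0 < t" "c * t = a / 2" "2 * t < 1" using assms by (auto simp: t_def field_simps)
  have s: "0 < s" "c * s = a * t" using t assms by (auto simp: s_def field_simps)
  have st: "(1 + \<rho>) * s \<le> t"
  proof -
    have "a * \<rho> \<le> b * \<rho>" "0 \<le> c * \<rho>" using \<rho>(1) assms by (auto intro: mult_right_mono)
    then have "(1 + \<rho>) * a \<le> c" using \<rho>(3) assms by (simp add: algebra_simps)
    then have "(1 + \<rho>) * a * t \<le> c * t" using t by (intro mult_right_mono) auto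
    moreover have "c * ((1 + \<rho>) * s) = (1 + \<rho>) * (a * t)"
      by (subst mult.left_commute) (simp only: s(2))
    ultimately have "c * ((1 + \<rho>) * s) \<le> c * t" by (simp only: mult.assoc)
    then show ?thesis using pos(3) by (simp only: mult_le_cancel_left_pos)
  qed
  have small: "pair_kernel a b c u v = 1 + of_bool (a * u < c * v) + of_bool (b * u < c * v)"
    if "0 < u" "u < t" "0 < v" "v < t" for u v
  proof -
    have "c * v \<le> c * t" "a * u \<le> c * t" "b * v \<le> c * t" "0 \<le> a * u" "0 \<le> b * u"
      using that assms by (auto intro!: mult_mono)
    moreover have "2 * (c * t) \<le> c" "c * t \<le> a" using t pos by auto
    ultimately have "a * u + b * v \<le> c" "c * v - a * u \<le> b" "c * v - b * u \<le> a"
      using assms(4) by linarith+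
    then show ?thesis unfolding pair_kernel_def by simp
  qed
  \<comment> \<open>The union of \<open>I\<close> and \<open>J\<close> lies between
    \<open>(1 - 2 * \<rho>) * s\<close> and \<open>(1 + \<rho>) * s\<close>. The ratio of these end
    points is below \<open>c / b\<close>, so \<open>b u < c v\<close> holds there for both orders of
    any two points.\<close>
  have ratio: "b * (1 + \<rho>) < c * (1 - 2 * \<rho>)" using \<rho>(3) by (simp add: algebra_simps)
  \<comment> \<open>\<open>I\<close> lies just above \<open>s\<close> and \<open>J\<close> just
    below it. For \<open>u\<close> slightly below \<open>t\<close>, the line
    \<open>c v = a u\<close> passes between them: the margin \<open>\<rho>\<close> is the same
    factor in \<open>J\<close> and in \<open>R\<close>.\<close>
  define I where "I = {s<..<(1 + \<rho>) * s}"
  define J where "J = {(1 - 2 * \<rho>) * s<..<(1 - \<rho>) * s}"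
  define R where "R = {(1 - \<rho>) * t<..<t}"
  have IJ: "(1 - 2 * \<rho>) * s < v" "v < (1 + \<rho>) * s" "0 < v" "v < t" if "v \<in> I \<union> J" for v
  proof -
    have "0 < \<rho> * s" "0 < (1 - 2 * \<rho>) * s" using \<rho> s by auto
    then show "(1 - 2 * \<rho>) * s < v" "v < (1 + \<rho>) * s" "0 < v" "v < t"
      using that st unfolding I_def J_def by (auto simp: algebra_simps)
  qed
  have diag: "b * u < c * v" "a * u < c * v" if "u \<in> I \<union> J" "v \<in> I \<union> J" for u v
  proof -
    have "b * u \<le> b * ((1 + \<rho>) * s)" using IJ[OF that(1)] assms by (intro mult_left_mono) auto
    moreover have "b * ((1 + \<rho>) * s) < c * ((1 - 2 * \<rho>) * s)"
      using mult_strict_right_mono[OF ratio s(1)] by (simp add: mult_ac)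
    moreover have "c * ((1 - 2 * \<rho>) * s) \<le> c * v"
      using IJ[OF that(2)] assms by (intro mult_left_mono) auto
    ultimately show "b * u < c * v" by linarith
    moreover have "a * u \<le> b * u" using IJ[OF that(1)] assms by (intro mult_right_mono) auto
    ultimately show "a * u < c * v" by linarith
  qed
  have Rt: "(1 - \<rho>) * t < u" "u < t" "0 < u" if "u \<in> R" for u
  proof -
    have "0 < (1 - \<rho>) * t" using \<rho> t by simp
    then show "(1 - \<rho>) * t < u" "u < t" "0 < u" using that unfolding R_def by auto
  qed
  have cross: "b * v < c * u" "a * v < c * u" if "u \<in> R" "v \<in> I \<union> J" for u v
  proof -
    have "b * v \<le> b * ((1 + \<rho>) * s)" using IJ[OF that(2)] assms by (intro mult_left_mono) auto
    moreover have "b * ((1 + \<rho>) * s) < c * ((1 - 2 * \<rho>) * s)"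
      using mult_strict_right_mono[OF ratio s(1)] by (simp add: mult_ac)
    moreover have "c * ((1 - 2 * \<rho>) * s) \<le> c * ((1 - \<rho>) * t)"
    proof (intro mult_left_mono mult_mono)
      have "0 \<le> \<rho> * s" using \<rho> s by simp
      then show "s \<le> t" using st by (simp add: algebra_simps)
    qed (use \<rho> s t assms in auto)
    moreover have "c * ((1 - \<rho>) * t) \<le> c * u" using Rt[OF that(1)] assms by (intro mult_left_mono) auto
    ultimately show "b * v < c * u" by linarith
    moreover have "a * v \<le> b * v" using IJ[OF that(2)] assms by (intro mult_right_mono) auto
    ultimately show "a * v < c * u" by linarith
  qed
  have high: "a * u < c * v" if "u \<in> R" "v \<in> I" for u v
  proof -
    have "a * u < a * t" using Rt[OF that(1)] assms by simp
    moreover have "c * s < c * v" using that assms by (simp add: I_def)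
    ultimately show ?thesis using s by linarith
  qed
  have low: "\<not> a * u < c * v" if "u \<in> R" "v \<in> J" for u v
  proof -
    have "c * v < c * ((1 - \<rho>) * s)" using that assms by (simp add: J_def)
    moreover have "c * ((1 - \<rho>) * s) = a * ((1 - \<rho>) * t)" using s(2) by (simp add: algebra_simps)
    moreover have "a * ((1 - \<rho>) * t) < a * u" using Rt[OF that(1)] assms by simp
    ultimately show ?thesis by linarith
  qed
  have low': "\<not> b * u < c * v" if "u \<in> R" "v \<in> J" for u v
  proof -
    have "a * u \<le> b * u" using Rt[OF that(1)] assms by (intro mult_right_mono) auto
    then show ?thesis using low[OF that] by linarith
  qed
  \<comment> \<open>On the union of \<open>I\<close> and \<open>J\<close> both orders give 3, hence
    6. A point of \<open>R\<close> as second argument also gives 3; as first argument it gives at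
    least 2 against \<open>I\<close> and exactly 1 against \<open>J\<close>.\<close>
  have "separates (pair_kernel a b c) I J R 6 4"
    unfolding separates_def
  proof (intro conjI ballI impI)
    show "I \<inter> J = {}"
    proof -
      have "0 < \<rho> * s" using \<rho> s by simp
      then show ?thesis unfolding I_def J_def by (auto simp: algebra_simps)
    qed
  qed (auto simp: small IJ Rt diag cross high low low')
  moreover have "subinterval I" "subinterval J" "subinterval R"
  proof -
    have "0 < \<rho> * s" "0 < (1 - 2 * \<rho>) * s" "0 < (1 - \<rho>) * t" "0 < \<rho> * t" using \<rho> s t by auto
    then show "subinterval I" "subinterval J" "subinterval R"
      using st t s unfolding I_def J_def R_def by (auto intro!: subintervalI simp: algebra_simps)
  qed
  ultimately show ?thesis by blast
qed

text \<open>The jump used is the line \<open>a u + b v = c\<close> near its end point \<open>(0, c / b)\<close>; since it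
  has negative slope, no other jump can cancel it.\<close>

lemma pair_kernel_separates_small:
  fixes a b c :: real
  assumes pos: "0 < a" "0 < b" "0 < c" and "a \<le> b" and "c \<le> b"
  shows "\<exists>I J R d e. subinterval I \<and> subinterval J \<and> subinterval R
    \<and> separates (pair_kernel a b c) I J R d e"
proof -
  \<comment> \<open>These conditions compare values at the corner \<open>(0, c / b)\<close>: an
    inequality that is strict there persists for \<open>u < 2 * t\<close> and \<open>v\<close>
    within \<open>3 * a * t / b\<close> of the corner. The implications cover comparisons whose
    outcome depends on the coefficients; the cases of equality are treated separately.\<close>
  have "\<forall>\<^sub>F t in at_right 0. (0 :: real) < t \<and> 3 * t < 1 \<and> (3 * (a + b)) * t < c
      \<and> (2 * c + 3 * a) * t < c \<and> (3 * a * c + 2 * b * b) * t < c * c \<and> (3 * a * c + 2 * a * b) * t < c * c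
      \<and> (2 * b * c + 3 * a * a) * t < a * c
      \<and> (a < b \<longrightarrow> (2 * b * b) * t < b * c - a * c)
      \<and> (a * b < c * c \<longrightarrow> (3 * a * c + 2 * b * b) * t < c * c - a * b)
      \<and> (a < c \<longrightarrow> (3 * a) * t < c - a) \<and> (c < a \<longrightarrow> (3 * a * a) * t < a * c - c * c)
      \<and> (c < b \<longrightarrow> (3 * a * b) * t < b * c - c * c)"
    using assms
    by (intro eventually_conj eventually_mult_less_at_right_0 eventually_at_right_less
        eventually_impI) auto
  then obtain t where t: "0 < t" "3 * t < 1" "(3 * (a + b)) * t < c"
      "(2 * c + 3 * a) * t < c" "(3 * a * c + 2 * b * b) * t < c * c" "(3 * a * c + 2 * a * b) * t < c * c"
      "(2 * b * c + 3 * a * a) * t < a * c"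
      "a < b \<Longrightarrow> (2 * b * b) * t < b * c - a * c"
      "a * b < c * c \<Longrightarrow> (3 * a * c + 2 * b * b) * t < c * c - a * b"
      "a < c \<Longrightarrow> (3 * a) * t < c - a" "c < a \<Longrightarrow> (3 * a * a) * t < a * c - c * c"
      "c < b \<Longrightarrow> (3 * a * b) * t < b * c - c * c"
    using eventually_happens trivial_limit_at_right_real by blast
  \<comment> \<open>For \<open>u\<close> in \<open>R\<close> the term \<open>a * u\<close> lies
    strictly between \<open>a * t\<close> and \<open>2 * a * t\<close>. So \<open>a u + b v\<close>
    is below \<open>c\<close> for \<open>v\<close> in \<open>I\<close> and above \<open>c\<close>
    for \<open>v\<close> in \<open>J\<close>.\<close>
  define I where "I = {(c - 3 * a * t) / b<..<(c - 2 * a * t) / b}"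
  define J where "J = {(c - a * t) / b<..<c / b}"
  define R where "R = {t<..<2 * t}"
  have at: "0 < a * t" "0 < b * t" "0 < c * t" using t assms by auto
  have IJ: "c - 3 * a * t < b * v" "b * v < c" if "v \<in> I \<union> J" for v
    using that at assms unfolding I_def J_def by (auto simp: field_simps)
  have I: "b * v < c - 2 * a * t" if "v \<in> I" for v
    using that assms unfolding I_def by (auto simp: field_simps)
  have J: "c - a * t < b * v" if "v \<in> J" for v
    using that assms unfolding J_def by (auto simp: field_simps)
  have pos_IJ: "0 < v" if "v \<in> I \<union> J" for v
  proof -
    have "3 * a * t < c" using t(3) at by (simp add: algebra_simps)
    then have "0 < b * v" using IJ[OF that] by linarith
    then show ?thesis using pos by (simp add: zero_less_mult_iff)
  qed
  have R: "t < u" "u < 2 * t" "0 < u" if "u \<in> R" for u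
    using that t(1) unfolding R_def by auto
  have up: "c * v < b" if "v \<in> I \<union> J" for v
  proof -
    have "c * (b * v) < c * c" using IJ[OF that] pos by simp
    also have "\<dots> \<le> b * b" using assms by (intro mult_mono) auto
    finally have "b * (c * v) < b * b" by (simp add: mult_ac)
    then show ?thesis using pos by simp
  qed
  have low_c: "c * (c - 3 * a * t) < b * (c * v)" and low_a: "a * (c - 3 * a * t) < b * (a * v)"
    and low_b: "b * (c - 3 * a * t) < b * (b * v)"
    and high_c: "b * (c * v) < c * c" and high_a: "b * (a * v) < a * c" if "v \<in> I \<union> J" for v
    using mult_strict_left_mono[OF IJ(1)[OF that] pos(3)] mult_strict_left_mono[OF IJ(1)[OF that] pos(1)]
      mult_strict_left_mono[OF IJ(1)[OF that] pos(2)] mult_strict_left_mono[OF IJ(2)[OF that] pos(3)]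
      mult_strict_left_mono[OF IJ(2)[OF that] pos(1)]
    by (simp_all add: mult_ac)
  have less_cancel: "x < y" if "b * x < b * y" for x y
    using that pos by simp
  have diag_first: "\<not> a * u + b * v \<le> c" if "u \<in> I \<union> J" "v \<in> I \<union> J" for u v
  proof -
    have "a * (3 * (a + b) * t) < a * c" "b * (3 * (a + b) * t) < b * c"
      using mult_strict_left_mono[OF t(3)] pos by auto
    then have "b * c < a * (c - 3 * a * t) + b * (c - 3 * a * t)" by (simp add: algebra_simps)
    also have "\<dots> < b * (a * u + b * v)"
      unfolding distrib_left using low_a[OF that(1)] low_b[OF that(2)] by linarith
    finally have "c < a * u + b * v" by (rule less_cancel)
    then show ?thesis by simp
  qed
  have diag_second: "(0 < c * v - a * u \<and> c * v - a * u \<le> b) = (a < c \<or> (a = c \<and> u < v))"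
    if uv: "u \<in> I \<union> J" "v \<in> I \<union> J" for u v
  proof -
    have le: "c * v - a * u \<le> b" using up[OF uv(2)] pos_IJ[OF uv(1)] pos by (smt (verit) mult_pos_pos)
    consider "a < c" | "a = c" | "c < a" by linarith
    then show ?thesis
    proof cases
      case 1
      have "c * (3 * a * t) < c * (c - a)" using t(10)[OF 1] pos by simp
      then have "b * (a * u) < b * (c * v)"
        using low_c[OF uv(2)] high_a[OF uv(1)] by (simp add: algebra_simps)
      from less_cancel[OF this] show ?thesis using le 1 by auto
    next
      case 2
      then show ?thesis using le pos by auto
    next
      case 3
      then have "b * (c * v) < b * (a * u)"
        using t(11) high_c[OF uv(2)] low_a[OF uv(1)] by (simp add: algebra_simps)
      from less_cancel[OF this] show ?thesis using 3 by auto
    qed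
  qed
  have diag_third: "(0 < c * v - b * u \<and> c * v - b * u \<le> a) = (c = b \<and> u < v)"
    if uv: "u \<in> I \<union> J" "v \<in> I \<union> J" for u v
  proof (cases "c = b")
    case True
    have "a * (3 * t) \<le> a * 1" using t pos by (intro mult_left_mono) auto
    then have "b * v - b * u \<le> a" using IJ[OF uv(1)] IJ[OF uv(2)] by simp
    then show ?thesis using True pos by auto
  next
    case False
    then have "c < b" using assms by simp
    then have "b * (c * v) < b * (b * u)"
      using t(12) high_c[OF uv(2)] low_b[OF uv(1)] by (simp add: algebra_simps)
    from less_cancel[OF this] show ?thesis using False by auto
  qed
  have cross_second: "0 < c * v - a * u \<and> c * v - a * u \<le> b" "\<not> 0 < c * u - a * v"
    if uv: "u \<in> R" "v \<in> I \<union> J" for u v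
  proof -
    have "a * b * u < a * b * (2 * t)" using R[OF uv(1)] pos by simp
    then have "b * (a * u) < b * (c * v)"
      using low_c[OF uv(2)] t(6) by (simp add: algebra_simps)
    moreover have "0 < a * u" using R[OF uv(1)] pos by simp
    ultimately show "0 < c * v - a * u \<and> c * v - a * u \<le> b"
      using less_cancel[of "a * u" "c * v"] up[OF uv(2)] by linarith
    have "b * c * u < b * c * (2 * t)" using R[OF uv(1)] pos by simp
    then have "b * (c * u) < b * (a * v)"
      using low_a[OF uv(2)] t(7) by (simp add: algebra_simps)
    then show "\<not> 0 < c * u - a * v" using less_cancel[of "c * u" "a * v"] by linarith
  qed
  have cross_third: "(0 < c * v - b * u \<and> c * v - b * u \<le> a) = (c * c \<le> a * b)" "\<not> 0 < c * u - b * v"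
    if uv: "u \<in> R" "v \<in> I \<union> J" for u v
  proof -
    have bbu: "b * b * u < b * b * (2 * t)" using R[OF uv(1)] pos by simp
    then have "b * (b * u) < b * (c * v)"
      using low_c[OF uv(2)] t(5) by (simp add: algebra_simps)
    then have 1: "0 < c * v - b * u" using less_cancel[of "b * u" "c * v"] by linarith
    \<comment> \<open>At the corner the difference equals \<open>c * c / b\<close>, to be compared
      with \<open>a\<close>. If these agree, \<open>b * v < c\<close> puts the difference on the
      admissible side.\<close>
    show "(0 < c * v - b * u \<and> c * v - b * u \<le> a) = (c * c \<le> a * b)"
    proof (cases "c * c \<le> a * b")
      case True
      then have "b * (c * v) < b * a" using high_c[OF uv(2)] by (simp add: mult_ac)
      moreover have "0 < b * u" using R[OF uv(1)] pos by simp
      ultimately show ?thesis using less_cancel[of "c * v" a] True 1 by linarith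
    next
      case False
      then have "b * a < b * (c * v - b * u)"
        using low_c[OF uv(2)] t(9) bbu by (simp add: algebra_simps)
      then show ?thesis using less_cancel[of a "c * v - b * u"] False by linarith
    qed
    have "c * u < c * (2 * t)" using R[OF uv(1)] pos by simp
    then show "\<not> 0 < c * u - b * v"
      using IJ[OF uv(2)] t(4) by (simp add: algebra_simps)
  qed
  have au: "a * t < a * u" "a * u < 2 * a * t" if "u \<in> R" for u
    using R[OF that] pos by simp_all
  have cross_I: "a * u + b * v \<le> c" "a * v + b * u \<le> c" if uv: "u \<in> R" "v \<in> I" for u v
  proof -
    show 1: "a * u + b * v \<le> c" using au[OF uv(1)] I[OF uv(2)] by linarith
    \<comment> \<open>The line with the arguments exchanged is the same line if
      \<open>a = b\<close>; otherwise the corner value \<open>a * c / b\<close> is strictly below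
      \<open>c\<close>.\<close>
    show "a * v + b * u \<le> c"
    proof (cases "a = b")
      case True
      then show ?thesis using 1 by (simp add: add.commute)
    next
      case False
      then have "a < b" using assms by simp
      have "b * b * u < b * b * (2 * t)" using R[OF uv(1)] pos by simp
      then have "b * (a * v + b * u) < b * c"
        using high_a[of v] uv(2) t(8)[OF \<open>a < b\<close>] by (simp add: algebra_simps)
      from less_cancel[OF this] show ?thesis by simp
    qed
  qed
  have cross_J: "\<not> a * u + b * v \<le> c" if uv: "u \<in> R" "v \<in> J" for u v
    using au[OF uv(1)] J[OF uv(2)] by linarith
  \<comment> \<open>On the union of \<open>I\<close> and \<open>J\<close> the first summand vanishes
    and the other two depend on how \<open>c\<close> compares with \<open>a\<close> and
    \<open>b\<close>. In a case of equality the condition becomes \<open>u < v\<close>, so exactly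
    one of the two orders counts.\<close>
  define d :: real where "d = (if a < c then 2 else of_bool (a = c)) + of_bool (c = b)"
  \<comment> \<open>With \<open>u\<close> in \<open>R\<close> first, the second summand is 1 and the
    third is 1 iff \<open>c * c \<le> a * b\<close>; in the opposite order both are 0. The first
    summand counts in both orders on \<open>I\<close>, but at most once on \<open>J\<close>.\<close>
  define e :: real where "e = 2 + of_bool (c * c \<le> a * b)"
  have "separates (pair_kernel a b c) I J R d e"
    unfolding separates_def
  proof (intro conjI ballI impI)
    show "0 \<le> d" by (simp add: d_def)
    show "I \<inter> J = {}" using I J at by fastforce
    fix u v assume uv: "u \<in> I \<union> J" "v \<in> I \<union> J" "u \<noteq> v"
    then show "pair_kernel a b c u v + pair_kernel a b c v u = d"
      unfolding pair_kernel_def diag_second[OF uv(1,2)] diag_second[OF uv(2,1)]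
        diag_third[OF uv(1,2)] diag_third[OF uv(2,1)] d_def
      using diag_first[OF uv(1,2)] diag_first[OF uv(2,1)] by auto
  next
    fix v u assume uv: "v \<in> I" "u \<in> R"
    then have v: "v \<in> I \<union> J" by simp
    show "e + 1 \<le> pair_kernel a b c v u + pair_kernel a b c u v"
      unfolding pair_kernel_def cross_third(1)[OF uv(2) v] e_def
      using cross_I[OF uv(2,1)] cross_second[OF uv(2) v] by simp
  next
    fix v u assume uv: "v \<in> J" "u \<in> R"
    then have v: "v \<in> I \<union> J" by simp
    show "pair_kernel a b c v u + pair_kernel a b c u v \<le> e"
      unfolding pair_kernel_def cross_third(1)[OF uv(2) v] e_def
      using cross_J[OF uv(2,1)] cross_second(2)[OF uv(2) v] cross_third(2)[OF uv(2) v] by auto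
  qed
  moreover have "subinterval I"
    unfolding I_def using at t(3) assms by (intro subintervalI) (auto simp: field_simps)
  moreover have "subinterval J"
    unfolding J_def using at t(3) assms by (intro subintervalI) (auto simp: field_simps)
  moreover have "subinterval R"
    unfolding R_def using t by (intro subintervalI) auto
  ultimately show ?thesis by blast
qed

section \<open>From the kernel to blocks of integers\<close>

lemma sum_of_bool_mult_eq:
  fixes c m n :: int
  assumes "0 < c" "c dvd m"
  shows "(\<Sum>w\<in>{1..n}. of_bool (c * w = m)) = (of_bool (0 < m \<and> m \<le> c * n) :: real)"
proof -
  obtain k where k: "m = c * k" using assms(2) by (rule dvdE)
  have "(\<Sum>w\<in>{1..n}. of_bool (c * w = m)) = (\<Sum>w\<in>{1..n}. if k = w then 1 else 0 :: real)"
    using assms(1) by (intro sum.cong) (auto simp: k)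
  then show ?thesis using assms(1) by (auto simp: k zero_less_mult_iff)
qed

text \<open>For multiples of \<open>a * b * c\<close> the missing variable is automatically an
  integer. Only its lying between 1 and \<open>n\<close> remains, and dividing by \<open>n\<close>
  gives the kernel conditions.\<close>

lemma pair_weight_eq_pair_kernel:
  fixes a b c n u v :: int
  assumes "0 < a" "0 < b" "0 < c" "a * b * c dvd u" "a * b * c dvd v" "u \<in> {1..n}" "v \<in> {1..n}"
  shows "pair_weight a b (- c) {1..n} u v =
    pair_kernel (of_int a) (of_int b) (of_int c) (of_int u / of_int n) (of_int v / of_int n)"
proof -
  have dvd: "a dvd u" "b dvd u" "c dvd u" "a dvd v" "b dvd v" "c dvd v"
    using assms(4,5) by (auto intro: dvd_trans[rotated])
  have n: "0 < n" "0 < real_of_int n" using assms by auto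
  have "(\<Sum>w\<in>{1..n}. of_bool (a * u + b * v + - c * w = 0)) = (\<Sum>w\<in>{1..n}. of_bool (c * w = a * u + b * v) :: real)"
    by (intro sum.cong refl arg_cong[of _ _ of_bool]) linarith
  also have "\<dots> = of_bool (0 < a * u + b * v \<and> a * u + b * v \<le> c * n)"
    using dvd assms by (intro sum_of_bool_mult_eq) auto
  also have "(0 < a * u + b * v \<and> a * u + b * v \<le> c * n) =
      (of_int a * (of_int u / of_int n) + of_int b * (of_int v / of_int n) \<le> (of_int c :: real))"
  proof -
    have "0 < a * u + b * v" using assms by (intro add_pos_pos mult_pos_pos) auto
    moreover have "(of_int a * (of_int u / of_int n) + of_int b * (of_int v / of_int n) \<le> (of_int c :: real))
       = (of_int (a * u + b * v) \<le> (of_int (c * n) :: real))"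
      using n by (simp add: field_simps)
    ultimately show ?thesis by (simp only: of_int_le_iff simp_thms)
  qed
  finally have 1: "(\<Sum>w\<in>{1..n}. of_bool (a * u + b * v + - c * w = 0)) =
    (of_bool (of_int a * (of_int u / of_int n) + of_int b * (of_int v / of_int n) \<le> (of_int c :: real)) :: real)" .
  have diff: "(\<Sum>w\<in>{1..n}. of_bool (q * w = c * v - p * u)) =
      (of_bool (0 < of_int c * (of_int v / of_int n) - of_int p * (of_int u / of_int n :: real) \<and>
      of_int c * (of_int v / of_int n) - of_int p * (of_int u / of_int n) \<le> (of_int q :: real)) :: real)"
    if "0 < q" "q dvd c * v - p * u" for p q
  proof -
    have eq: "of_int c * (of_int v / of_int n) - of_int p * (of_int u / of_int n) = of_int (c * v - p * u) / real_of_int n"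
      using n by (simp add: field_simps)
    have "(of_int (c * v - p * u) / real_of_int n \<le> of_int q) = (of_int (c * v - p * u) \<le> real_of_int (q * n))"
      using n by (simp add: pos_divide_le_eq)
    moreover have "(0 < of_int (c * v - p * u) / real_of_int n) = (0 < real_of_int (c * v - p * u))"
      using n by (simp only: zero_less_divide_iff) auto
    ultimately show ?thesis
      unfolding sum_of_bool_mult_eq[OF that] eq by (simp only: of_int_le_iff of_int_0_less_iff)
  qed
  have "(\<Sum>w\<in>{1..n}. of_bool (a * u + b * w + - c * v = 0)) = (\<Sum>w\<in>{1..n}. of_bool (b * w = c * v - a * u) :: real)"
    by (intro sum.cong refl arg_cong[of _ _ of_bool]) linarith
  moreover have "(\<Sum>w\<in>{1..n}. of_bool (a * w + b * u + - c * v = 0)) = (\<Sum>w\<in>{1..n}. of_bool (a * w = c * v - b * u) :: real)"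
    by (intro sum.cong refl arg_cong[of _ _ of_bool]) linarith
  ultimately show ?thesis
    unfolding pair_weight_def pair_kernel_def 1 using diff[of b a] diff[of a b] dvd assms by simp
qed

lemma exists_block_of_multiples:
  fixes N n :: int and l r :: real
  assumes "0 < N" "0 < n" "0 \<le> l" "r \<le> 1" "of_int N * (real s + 1) \<le> (r - l) * of_int n"
  shows "\<exists>P\<subseteq>{1..n}. card P = s \<and> (\<forall>x\<in>P. N dvd x \<and> of_int x / of_int n \<in> {l<..<r})"
proof -
  \<comment> \<open>\<open>N * k\<close> is the last multiple of \<open>N\<close> not exceeding
    \<open>l * n\<close>, so the block starts at the first multiple strictly above. The additional
    \<open>N\<close> in the length assumption makes the upper bound strict.\<close>
  define k where "k = \<lfloor>l * of_int n / of_int N\<rfloor>"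
  define P where "P = (\<lambda>i. N * (k + int i)) ` {1..s}"
  have "inj_on (\<lambda>i. N * (k + int i)) {1..s}" using assms(1) by (auto simp: inj_on_def)
  then have "card P = s" by (simp add: P_def card_image)
  moreover have bounds: "l * of_int n < of_int x" "of_int x < r * of_int n" if "x \<in> P" for x
  proof -
    obtain i where i: "x = N * (k + int i)" "1 \<le> i" "i \<le> s" using \<open>x \<in> P\<close> unfolding P_def by fastforce
    have k: "of_int k \<le> l * of_int n / of_int N" "l * of_int n / of_int N < of_int k + 1"
      unfolding k_def by linarith+
    have k': "of_int N * of_int k \<le> l * of_int n" "l * of_int n < of_int N * (of_int k + 1)"
      using k assms(1) by (simp_all add: field_simps)
    have "of_int N * (of_int k + 1) \<le> real_of_int N * (of_int k + real i)"
      using assms(1) i by (intro mult_left_mono) auto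
    then show "l * of_int n < of_int x" using k' by (simp add: i)
    have "real_of_int N * real i < of_int N * (real s + 1)"
      using assms(1) i by (intro mult_strict_left_mono) auto
    then show "of_int x < r * of_int n" using k' assms(5) by (simp add: i algebra_simps)
  qed
  moreover have "x \<in> {1..n}" if "x \<in> P" for x
  proof -
    have "0 \<le> l * of_int n" "r * of_int n \<le> 1 * of_int n"
      using assms by (auto intro: mult_right_mono)
    then have "0 < real_of_int x" "real_of_int x < of_int n" using bounds[OF that] by linarith+
    then show ?thesis by simp
  qed
  moreover have "N dvd x" if "x \<in> P" for x using that by (auto simp: P_def)
  ultimately show ?thesis
    using assms(2) by (intro exI[of _ P]) (auto simp: field_simps)
qed

section \<open>Colorings with a form of order - n^2, for all sign patterns\<close>

text \<open>Stated through \<open>pair_sum\<close>, so that permuting or negating the coefficients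
  is immediate and needs no reindexing of solution lists.\<close>

definition has_negative_colorings :: "int \<Rightarrow> int \<Rightarrow> int \<Rightarrow> bool" where
  "has_negative_colorings a b c \<longleftrightarrow> (\<exists>\<delta>>0. \<forall>\<^sub>F n in sequentially. \<exists>f.
     (\<forall>x\<in>{1..int n}. f x \<in> {-1, 1}) \<and> pair_sum a b c {1..int n} f \<le> - \<delta> * real n ^ 2)"

lemma has_negative_colorings_swap12: "has_negative_colorings a b c = has_negative_colorings b a c"
  unfolding has_negative_colorings_def pair_sum_swap12[of a b] ..

lemma has_negative_colorings_swap23: "has_negative_colorings a b c = has_negative_colorings a c b"
  unfolding has_negative_colorings_def pair_sum_swap23[of a b] ..

lemma has_negative_colorings_uminus:
  "has_negative_colorings (- a) (- b) (- c) = has_negative_colorings a b c"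
  unfolding has_negative_colorings_def pair_sum_uminus ..

text \<open>The linear terms amount to at most 4 n, hence to at most y/512, which is half of the
  gain y/256.\<close>

lemma quadratic_beats_linear:
  fixes x s q y :: real
  assumes "y \<le> q" "4 * 512 * real n \<le> y" "x \<le> 3 * real n + (6 * s - q / 16) / 16" "s \<le> real n"
  shows "x \<le> - y / 512"
proof -
  have "0 \<le> real n" by simp
  then show ?thesis using assms by (simp add: field_simps)
qed

lemma has_negative_colorings_ordered:
  fixes a b c :: int
  assumes "0 < a" "0 < b" "0 < c" "a \<le> b"
  shows "has_negative_colorings a b (- c)"
proof -
  let ?k = "pair_kernel (of_int a) (of_int b) (of_int c)"
  obtain I J R d e where sub: "subinterval I" "subinterval J" "subinterval R"
    and sep: "separates ?k I J R d e"
    using pair_kernel_separates_large[of "of_int a" "of_int b" "of_int c"]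
      pair_kernel_separates_small[of "of_int a" "of_int b" "of_int c"] assms
    by (cases "b < c") auto
  obtain l1 r1 where 1: "0 \<le> l1" "l1 < r1" "r1 \<le> 1" "I = {l1<..<r1}"
    using sub(1) unfolding subinterval_def by blast
  obtain l2 r2 where 2: "0 \<le> l2" "l2 < r2" "r2 \<le> 1" "J = {l2<..<r2}"
    using sub(2) unfolding subinterval_def by blast
  obtain l3 r3 where 3: "0 \<le> l3" "l3 < r3" "r3 \<le> 1" "R = {l3<..<r3}"
    using sub(3) unfolding subinterval_def by blast
  define N where "N = a * b * c"
  have N: "0 < N" using assms by (simp add: N_def)
  then have N1: "1 \<le> real_of_int N" by linarith
  define \<nu> where "\<nu> = min (r1 - l1) (min (r2 - l2) (r3 - l3))"
  have \<nu>: "0 < \<nu>" "\<nu> \<le> 1" "\<nu> \<le> r1 - l1" "\<nu> \<le> r2 - l2" "\<nu> \<le> r3 - l3"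
    using 1 2 3 by (auto simp: \<nu>_def)
  \<comment> \<open>With \<open>s\<close> the floor of \<open>2 * \<kappa> * n\<close> and
    \<open>\<kappa> * n \<ge> 1\<close>, one gets \<open>s + 1 \<le> 4 * \<kappa> * n\<close>. Then
    \<open>N * (s + 1) \<le> \<nu> * n\<close>, so a block of \<open>s\<close> multiples fits into
    even the shortest of the three intervals.\<close>
  define \<kappa> where "\<kappa> = \<nu> / (4 * of_int N)"
  have \<kappa>: "0 < \<kappa>" "4 * \<kappa> * of_int N = \<nu>" using \<nu> N1 by (simp_all add: \<kappa>_def)
  have "\<exists>f. (\<forall>x\<in>{1..int n}. f x \<in> {-1, 1}) \<and>
      pair_sum a b (- c) {1..int n} f \<le> - (\<kappa>\<^sup>2 / 512) * real n ^ 2"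
    if n: "real n \<ge> 1 / \<kappa>" "real n \<ge> 4 * 512 / \<kappa>\<^sup>2" for n
  proof -
    \<comment> \<open>The first bound keeps \<open>s\<close> above \<open>\<kappa> * n\<close>
      despite the floor; the second is the threshold at which the quadratic gain exceeds the linear
      loss.\<close>
    have n\<kappa>: "1 \<le> \<kappa> * real n" "4 * 512 \<le> \<kappa>\<^sup>2 * real n"
      using n \<kappa>(1) by (simp_all add: field_simps)
    have n0: "0 < int n" using n\<kappa>(1) by (cases n) auto
    define s where "s = nat \<lfloor>2 * \<kappa> * real n\<rfloor>"
    have s: "real s \<le> 2 * \<kappa> * real n" "2 * \<kappa> * real n < real s + 1"
      unfolding s_def using \<kappa>(1) by (simp_all add: of_nat_nat)
    have s_lower: "\<kappa> * real n \<le> real s" using s n\<kappa> by linarith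
    have "4 * \<kappa> * 1 \<le> 4 * \<kappa> * of_int N" using \<kappa> N1 by (intro mult_left_mono) auto
    then have "2 * \<kappa> * real n \<le> 1 * real n" using \<kappa> \<nu> by (intro mult_right_mono) auto
    then have s_upper: "real s \<le> real n" using s by linarith
    have "of_int N * (real s + 1) \<le> of_int N * (4 * \<kappa> * real n)"
      using s n\<kappa> N1 by (intro mult_left_mono) auto
    also have "\<dots> = \<nu> * real n" using \<kappa>(2) by (metis mult.assoc mult.commute)
    finally have len: "of_int N * (real s + 1) \<le> \<nu> * real n" .
    have fits: "of_int N * (real s + 1) \<le> (r - l) * of_int (int n)" if "\<nu> \<le> r - l" for l r
      using len mult_right_mono[OF that, of "real n"] by simp
    obtain P where P: "P \<subseteq> {1..int n}" "card P = s" "\<And>x. x \<in> P \<Longrightarrow> N dvd x"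
      "\<And>x. x \<in> P \<Longrightarrow> of_int x / of_int (int n) \<in> I"
      using exists_block_of_multiples[OF N n0 1(1,3) fits[OF \<nu>(3)]] unfolding 1(4) by blast
    obtain P' where P': "P' \<subseteq> {1..int n}" "card P' = s" "\<And>x. x \<in> P' \<Longrightarrow> N dvd x"
      "\<And>x. x \<in> P' \<Longrightarrow> of_int x / of_int (int n) \<in> J"
      using exists_block_of_multiples[OF N n0 2(1,3) fits[OF \<nu>(4)]] unfolding 2(4) by blast
    obtain R' where R': "R' \<subseteq> {1..int n}" "card R' = s" "\<And>x. x \<in> R' \<Longrightarrow> N dvd x"
      "\<And>x. x \<in> R' \<Longrightarrow> of_int x / of_int (int n) \<in> R"
      using exists_block_of_multiples[OF N n0 3(1,3) fits[OF \<nu>(5)]] unfolding 3(4) by blast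
    let ?W = "pair_weight a b (- c) {1..int n}"
    have W: "?W u v = ?k (of_int u / of_int (int n)) (of_int v / of_int (int n))"
      if "u \<in> P \<union> P' \<union> R'" "v \<in> P \<union> P' \<union> R'" for u v
      using that P(1,3) P'(1,3) R'(1,3) assms unfolding N_def
      by (intro pair_weight_eq_pair_kernel) blast+
    have "\<exists>f. (\<forall>x\<in>{1..int n}. f x \<in> {-1, 1}) \<and>
      (\<Sum>u\<in>{1..int n}. \<Sum>v\<in>{1..int n}. ?W u v * f u * f v)
        \<le> 3 * real (card {1..int n}) + (6 * real s - real s ^ 2 / 16) / 16"
    proof (rule exists_negative_coloring[where P = P and P' = P' and R = R' and d = d and e = e])
      show "P \<inter> P' = {}" using sep P(4) P'(4) unfolding separates_def by blast
      show "0 \<le> d" using sep by (simp add: separates_def)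
      show "0 \<le> ?W u v" "?W u v \<le> 3" for u v
        using pair_weight_bounds[of "{1..int n}" a b "- c"] assms by auto
      show "?W u v + ?W v u = d" if "u \<in> P \<union> P'" "v \<in> P \<union> P'" "u \<noteq> v" for u v
      proof -
        have "of_int u / real_of_int (int n) \<noteq> of_int v / of_int (int n)" using that n0 by simp
        moreover have "of_int u / of_int (int n) \<in> I \<union> J" "of_int v / of_int (int n) \<in> I \<union> J"
          using that P(4) P'(4) by auto
        ultimately show ?thesis
          using sep that W[of u v] W[of v u] unfolding separates_def by simp
      qed
      show "e + 1 \<le> ?W u v + ?W v u" if "u \<in> P" "v \<in> R'" for u v
        using sep that W[of u v] W[of v u] P(4) R'(4) unfolding separates_def by simp
      show "?W u v + ?W v u \<le> e" if "u \<in> P'" "v \<in> R'" for u v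
        using sep that W[of u v] W[of v u] P'(4) R'(4) unfolding separates_def by simp
    qed (use P P' R' in auto)
    then obtain f where f: "\<forall>x\<in>{1..int n}. f x \<in> {-1, 1}"
      and le: "pair_sum a b (- c) {1..int n} f \<le> 3 * real n + (6 * real s - real s ^ 2 / 16) / 16"
      unfolding pair_sum_eq_pair_weight by auto
    have "(\<kappa> * real n)\<^sup>2 \<le> (real s)\<^sup>2"
      using s_lower \<kappa>(1) by (intro power_mono) auto
    then have "\<kappa>\<^sup>2 * real n ^ 2 \<le> real s ^ 2" by (simp only: power_mult_distrib)
    moreover have "4 * 512 * real n \<le> \<kappa>\<^sup>2 * real n ^ 2"
      using mult_right_mono[OF n\<kappa>(2), of "real n"] by (simp add: power2_eq_square mult.assoc)
    ultimately have "pair_sum a b (- c) {1..int n} f \<le> - (\<kappa>\<^sup>2 * real n ^ 2) / 512"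
      using quadratic_beats_linear le s_upper by blast
    then have "pair_sum a b (- c) {1..int n} f \<le> - (\<kappa>\<^sup>2 / 512) * real n ^ 2" by simp
    then show ?thesis using f by blast
  qed
  moreover have "\<forall>\<^sub>F n in sequentially. real n \<ge> 1 / \<kappa> \<and> real n \<ge> 4 * 512 / \<kappa>\<^sup>2"
    using filterlim_real_sequentially unfolding filterlim_at_top
    by (intro eventually_conj) blast+
  ultimately have "\<forall>\<^sub>F n in sequentially. \<exists>f. (\<forall>x\<in>{1..int n}. f x \<in> {-1, 1}) \<and>
      pair_sum a b (- c) {1..int n} f \<le> - (\<kappa>\<^sup>2 / 512) * real n ^ 2"
    by (auto elim!: eventually_mono)
  then show ?thesis
    unfolding has_negative_colorings_def using \<kappa>(1) by (intro exI[of _ "\<kappa>\<^sup>2 / 512"]) auto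
qed

lemma has_negative_colorings_pos_pos_neg:
  assumes "0 < a" "0 < b" "c < 0"
  shows "has_negative_colorings a b c"
  using has_negative_colorings_ordered[of a b "- c"] has_negative_colorings_ordered[of b a "- c"]
    has_negative_colorings_swap12[of a b c] assms
  by (cases "a \<le> b") auto

text \<open>Two of the three coefficients share a sign and the third has the other one. Permuting
  moves it to the end, and negating makes the pair positive if necessary.\<close>

lemma has_negative_colorings_mixed_signs:
  assumes "a \<noteq> 0" "b \<noteq> 0" "c \<noteq> 0" "\<not> (sgn a = sgn b \<and> sgn b = sgn c)"
  shows "has_negative_colorings a b c"
proof -
  have pos: "has_negative_colorings p q r"
    if "p \<noteq> 0" "q \<noteq> 0" "r \<noteq> 0" "sgn p = sgn q" "sgn q \<noteq> sgn r" for p q r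
  proof (cases "0 < p")
    case True
    then show ?thesis
      using that by (intro has_negative_colorings_pos_pos_neg) (auto simp: sgn_if split: if_splits)
  next
    case False
    have "has_negative_colorings (- p) (- q) (- r)"
      using that False by (intro has_negative_colorings_pos_pos_neg) (auto simp: sgn_if split: if_splits)
    then show ?thesis by (simp only: has_negative_colorings_uminus)
  qed
  consider "sgn a = sgn b" "sgn b \<noteq> sgn c" | "sgn a = sgn c" "sgn c \<noteq> sgn b" | "sgn b = sgn c" "sgn c \<noteq> sgn a"
    using assms by (cases "0 < a"; cases "0 < b"; cases "0 < c") (simp_all add: sgn_if)
  then show ?thesis
  proof cases
    case 1
    then show ?thesis using pos assms by blast
  next
    case 2
    then show ?thesis using pos[of a c b] assms has_negative_colorings_swap23[of a b c] by blast
  next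
    case 3
    then show ?thesis
      using pos[of b c a] assms has_negative_colorings_swap12[of a b c]
        has_negative_colorings_swap23[of b a c] by blast
  qed
qed

section \<open>Counting monochromatic solutions\<close>

lemma card_triple_lists:
  assumes "finite A"
  shows "real (card {[x, y, z] | x y z. x \<in> A \<and> y \<in> A \<and> z \<in> A \<and> P x y z})
    = (\<Sum>x\<in>A. \<Sum>y\<in>A. \<Sum>z\<in>A. of_bool (P x y z))"
proof -
  let ?S = "(A \<times> A \<times> A) \<inter> {(x, y, z). P x y z}"
  have "{[x, y, z] | x y z. x \<in> A \<and> y \<in> A \<and> z \<in> A \<and> P x y z} = (\<lambda>(x, y, z). [x, y, z]) ` ?S"
    by (force simp: image_iff)
  moreover have "inj_on (\<lambda>(x, y, z). [x, y, z]) ?S" by (auto simp: inj_on_def)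
  ultimately have "card {[x, y, z] | x y z. x \<in> A \<and> y \<in> A \<and> z \<in> A \<and> P x y z} = card ?S"
    by (simp add: card_image)
  moreover have "real (card ?S) = (\<Sum>p\<in>A \<times> A \<times> A. of_bool (case p of (x, y, z) \<Rightarrow> P x y z))"
    using assms by (subst sum_of_bool_eq) auto
  moreover have "\<dots> = (\<Sum>x\<in>A. \<Sum>y\<in>A. \<Sum>z\<in>A. of_bool (P x y z))"
    by (simp add: sum.cartesian_product case_prod_unfold)
  ultimately show ?thesis by simp
qed

lemma card_solutions_three:
  assumes "finite A"
  shows "real (card (solutions [a, b, c] A))
    = (\<Sum>x\<in>A. \<Sum>y\<in>A. \<Sum>z\<in>A. of_bool (a * x + b * y + c * z = 0))"
  unfolding solutions_three by (rule card_triple_lists[OF assms])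

lemma card_solutions_le:
  assumes "finite A" "c \<noteq> 0"
  shows "real (card (solutions [a, b, c] A)) \<le> real (card A) ^ 2"
proof -
  have "real (card (solutions [a, b, c] A)) \<le> (\<Sum>x\<in>A. \<Sum>y\<in>A. 1)"
    unfolding card_solutions_three[OF assms(1)]
  proof (intro sum_mono sum_of_bool_le_one assms(1))
    fix x y z z' assume "a * x + b * y + c * z = 0" "a * x + b * y + c * z' = 0"
    then have "c * z = c * z'" by linarith
    then show "z = z'" using assms by simp
  qed
  then show ?thesis by (simp add: power2_eq_square)
qed

text \<open>Links the real signs \<open>f\<close> of the quadratic form to the integer-valued
  coloring \<open>F\<close>; they need to correspond only on \<open>A\<close>, which leaves room for
  an extensional \<open>F\<close>.\<close>

lemma card_mono_solutions:
  assumes "finite A" and f: "\<And>x. x \<in> A \<Longrightarrow> f x \<in> {-1, 1 :: real}"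
    and F: "\<And>x. x \<in> A \<Longrightarrow> F x = (if f x = 1 then 1 else -1)"
  shows "4 * real (card (mono_solutions [a, b, c] A F))
    = real (card (solutions [a, b, c] A)) + pair_sum a b c A f"
proof -
  have mono: "(\<forall>v\<in>set [x, y, z]. \<forall>w\<in>set [x, y, z]. F v = F w) = (F x = F y \<and> F y = F z)" for x y z
    by (simp, metis)
  have "mono_solutions [a, b, c] A F = {[x, y, z] | x y z. x \<in> A \<and> y \<in> A \<and> z \<in> A \<and>
      (a * x + b * y + c * z = 0 \<and> F x = F y \<and> F y = F z)}"
    unfolding mono_solutions_def solutions_three mono[symmetric] by blast
  then have "4 * real (card (mono_solutions [a, b, c] A F)) = (\<Sum>x\<in>A. \<Sum>y\<in>A. \<Sum>z\<in>A.
      4 * of_bool (a * x + b * y + c * z = 0 \<and> F x = F y \<and> F y = F z))"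
    by (simp only: card_triple_lists[OF assms(1)] sum_distrib_left)
  also have "\<dots> = (\<Sum>x\<in>A. \<Sum>y\<in>A. \<Sum>z\<in>A. of_bool (a * x + b * y + c * z = 0)
      + of_bool (a * x + b * y + c * z = 0) * (f x * f y + f x * f z + f y * f z))"
  proof (intro sum.cong refl)
    fix x y z assume "x \<in> A" "y \<in> A" "z \<in> A"
    then show "4 * of_bool (a * x + b * y + c * z = 0 \<and> F x = F y \<and> F y = F z)
      = of_bool (a * x + b * y + c * z = 0)
      + of_bool (a * x + b * y + c * z = 0) * (f x * f y + f x * f z + f y * f z)"
      using f[of x] f[of y] f[of z] F[of x] F[of y] F[of z] by (auto simp: of_bool_def)
  qed
  finally show ?thesis
    unfolding pair_sum_def card_solutions_three[OF assms(1)] sum.distrib .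
qed

lemma min_mono_ratio_le:
  assumes "c \<noteq> 0" "0 < \<delta>" "0 < n" and f: "\<forall>x\<in>{1..int n}. f x \<in> {-1, 1}"
    and neg: "pair_sum a b c {1..int n} f \<le> - \<delta> * real n ^ 2"
  shows "min_mono_ratio [a, b, c] {1..int n} \<le> 1 / 4 - \<delta> / 4"
proof -
  define F where "F = restrict (\<lambda>x. if f x = 1 then 1 else -1 :: int) {1..int n}"
  define m where "m = real (card (solutions [a, b, c] {1..int n}))"
  have col: "F \<in> colorings {1..int n}" unfolding colorings_def F_def by auto
  have "finite (colorings {1..int n})" unfolding colorings_def by (intro finite_PiE) auto
  then have "min_mono_ratio [a, b, c] {1..int n} \<le> mono_ratio [a, b, c] {1..int n} F"
    unfolding min_mono_ratio_def using col by (intro Min_le) auto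
  also have "\<dots> \<le> 1 / 4 - \<delta> / 4"
  proof -
    have eq: "4 * real (card (mono_solutions [a, b, c] {1..int n} F)) = m + pair_sum a b c {1..int n} f"
      unfolding m_def using f by (intro card_mono_solutions) (auto simp: F_def)
    have "m \<le> real n ^ 2"
      unfolding m_def using card_solutions_le[of "{1..int n}" c a b] assms(1) by simp
    \<comment> \<open>Replacing n^2 by the number \<open>m\<close> of solutions makes the loss
      proportional to the denominator of the ratio.\<close>
    then have "\<delta> * m \<le> \<delta> * real n ^ 2" using assms(2) by (intro mult_left_mono) auto
    moreover have "0 < \<delta> * real n ^ 2" using assms(2,3) by simp
    \<comment> \<open>Positivity of \<open>m\<close> also comes from the identity: its left side is
      nonnegative although the form is negative. So the convention for division by 0 never
      applies.\<close>
    ultimately have "4 * real (card (mono_solutions [a, b, c] {1..int n} F)) \<le> m - \<delta> * m" "0 < m"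
      using eq neg by linarith+
    then show ?thesis
      unfolding mono_ratio_def m_def[symmetric] by (simp add: field_simps)
  qed
  finally show ?thesis .
qed

theorem theorem2p1:
  fixes a b c :: int
  assumes "a \<noteq> 0" and "b \<noteq> 0" and "c \<noteq> 0"
    and "\<not> (sgn a = sgn b \<and> sgn b = sgn c)"
  shows "uncommon [a, b, c]"
proof -
  obtain \<delta> where \<delta>: "0 < \<delta>" and ev: "\<forall>\<^sub>F n in sequentially. \<exists>f.
     (\<forall>x\<in>{1..int n}. f x \<in> {-1, 1}) \<and> pair_sum a b c {1..int n} f \<le> - \<delta> * real n ^ 2"
    using has_negative_colorings_mixed_signs[OF assms] unfolding has_negative_colorings_def by blast
  \<comment> \<open>Since \<open>\<delta>\<close> does not depend on \<open>n\<close>, the strict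
    inequality survives the limsup.\<close>
  have "\<forall>\<^sub>F n in sequentially. ereal (min_mono_ratio [a, b, c] {1..int n}) \<le> ereal (1 / 4 - \<delta> / 4)"
    using ev eventually_gt_at_top[of 0]
    by eventually_elim (use min_mono_ratio_le[OF assms(3) \<delta>] in auto)
  then have "limsup (\<lambda>n. ereal (min_mono_ratio [a, b, c] {1..int n})) \<le> ereal (1 / 4 - \<delta> / 4)"
    by (rule Limsup_bounded)
  also have "\<dots> < ereal (1 / 4)" using \<delta> by simp
  also have "ereal (1 / 4) = 1 / 4" by (simp add: one_ereal_def numeral_eq_ereal)
  finally show ?thesis unfolding uncommon_three .
qed

end
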